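(* Let $\mathcal{D}=\mathcal{Z}_m\cap\mathcal{Z}_s\subseteq\mathbb{R}^n$ be an InterZono with main domain $\mathcal{Z}_m$ and support domain $\mathcal{Z}_s$, and let $\mathcal{D}'=\mathcal{Z}_m'\cap\mathcal{Z}_s'$ be the output InterZono of the tanh abstract transformer applied to $\mathcal{D}$. Then $\mathcal{D}'$ is a tighter over-approximation (superset) of the image of $\mathcal{Z}_m$ under componentwise $\tanh$. That is, $$\{\tanh(\boldsymbol{x}):\boldsymbol{x}\in\mathcal{Z}_m\}\subseteq\mathcal{D}',$$ and $\mathcal{D}'$ is tighter than each of $\mathcal{Z}_m'$ (the output of the parallelogram-style transformer) and $\mathcal{Z}_s'$ (the output of the box-style transformer), being their intersection.
   Context: A Zonotope in $\mathbb{R}^n$ is a set $\mathcal{Z}=\{\boldsymbol{\alpha}_0+\sum_{i=1}^N\boldsymbol{\alpha}_i\epsilon_i:\epsilon_i\in[-1,1]\}$ with $\boldsymbol{\alpha}_0,\dots,\boldsymbol{\alpha}_N\in\mathbb{R}^n$. Its lower and upper bounds are $\boldsymbol{\alpha}_0-\sum_i|\boldsymbol{\alpha}_i|$ and $\boldsymbol{\alpha}_0+\sum_i|\boldsymbol{\alpha}_i|$ (absolute values componentwise). An InterZono is an intersection $\mathcal{D}=\mathcal{Z}_m\cap\mathcal{Z}_s$ of two Zonotopes, called the main domain and the support domain. If $\boldsymbol{l}_m,\boldsymbol{u}_m$ and $\boldsymbol{l}_s,\boldsymbol{u}_s$ are the bounds of $\mathcal{Z}_m$ and $\mathcal{Z}_s$,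 the bounds of $\mathcal{D}$ are $\boldsymbol{l}=\max\{\boldsymbol{l}_m,\boldsymbol{l}_s\}$ and $\boldsymbol{u}=\min\{\boldsymbol{u}_m,\boldsymbol{u}_s\}$ (componentwise). The tanh abstract transformer for InterZono: let $\mathcal{Z}_m=\{\boldsymbol{\alpha}_0+\sum_{i=1}^N\boldsymbol{\alpha}_i\epsilon_i:\epsilon_i\in[-1,1]\}$ and let $\boldsymbol{l},\boldsymbol{u}$ be the bounds of $\mathcal{D}$ (not those of $\mathcal{Z}_m$). For $j=1,\dots,n$ put $k_j=(\tanh(u_j)-\tanh(l_j))/(u_j-l_j)$, and let $y=k_jx+c_j$ and $y=k_jx+d_j$ be the parallel upper and lower bounding lines of $\tanh$ on $[l_j,u_j]$ with slope $k_j$ and minimal distance. With $\boldsymbol{k},\boldsymbol{c},\boldsymbol{d}$ the corresponding vectors, $\odot$ the componentwise product and $\boldsymbol{e}_j$ the $j$-th standard basis vector, the new main domain (parallelogram-style transformer applied to $\mathcal{Z}_m$) is $$\mathcal{Z}_m'=\Big\{\boldsymbol{\alpha}_0\odot\boldsymbol{k}+\tfrac{\boldsymbol{c}+\boldsymbol{d}}{2}+\sum_{i=1}^N(\boldsymbol{\alpha}_i\odot\boldsymbol{k})\epsilon_i+\sum_{j=1}^n\tfrac{c_j-d_j}{2}\boldsymbol{e}_j\epsilon_{N+j}:\epsilon_i\in[-1,1]\Big\},$$ and the new support domain (box-style transformer) is $$\mathcal{Z}_s'=\Big\{\tfrac{\tanh(\boldsymbol{u})+\tanh(\boldsymbol{l})}{2}+\sum_{j=1}^n\tfrac{\tanh(u_j)-\tanh(l_j)}{2}\boldsymbol{e}_j\epsilon_j:\epsilon_j\in[-1,1]\Big\}.$$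 The output InterZono is $\mathcal{D}'=\mathcal{Z}_m'\cap\mathcal{Z}_s'$.
   Formalization: The inclusion of tanh(Z_m) in D' fails in general (Z_m=[-1,1], Z_s=[-1/2,1/2]); proved instead are tanh(D) ⊆ D' always, and tanh(Z_m) ⊆ D' when Z_m lies within the bounds [l,u] of D. *)

theory Defs
  imports "HOL-Analysis.Analysis"
begin

text \<open>The transformer and the bounds depend on the generator representation, so a zonotope is
  represented by its centre and its indexed generators. The index set is a finite set \<open>idx\<close>
  rather than a type, so that it may be empty. The Euclidean space is \<open>real ^ 'n\<close>; the library's
  product and order on this type are the componentwise ones.\<close>

record ('i, 'n) zono =
  idx :: "'i set"
  ctr :: "real ^ 'n"
  gen :: "'i \<Rightarrow> real ^ 'n"

definition zset :: "('i, 'n::finite) zono \<Rightarrow> (real ^ 'n) set" where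
  "zset Z = {ctr Z + (\<Sum>i\<in>idx Z. \<epsilon> i *\<^sub>R gen Z i) | \<epsilon>. \<forall>i\<in>idx Z. \<epsilon> i \<in> {-1..1}}"

definition zlower :: "('i, 'n::finite) zono \<Rightarrow> real ^ 'n" where
  "zlower Z = (\<chi> j. ctr Z $ j - (\<Sum>i\<in>idx Z. \<bar>gen Z i $ j\<bar>))"

definition zupper :: "('i, 'n::finite) zono \<Rightarrow> real ^ 'n" where
  "zupper Z = (\<chi> j. ctr Z $ j + (\<Sum>i\<in>idx Z. \<bar>gen Z i $ j\<bar>))"

text \<open>An InterZono is the pair of its main domain and its support domain.\<close>

type_synonym ('i, 's, 'n) interzono = "('i, 'n) zono \<times> ('s, 'n) zono"

definition iz_set :: "('i, 's, 'n::finite) interzono \<Rightarrow> (real ^ 'n) set" where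
  "iz_set D = zset (fst D) \<inter> zset (snd D)"

definition iz_lower :: "('i, 's, 'n::finite) interzono \<Rightarrow> real ^ 'n" where
  "iz_lower D = (\<chi> j. max (zlower (fst D) $ j) (zlower (snd D) $ j))"

definition iz_upper :: "('i, 's, 'n::finite) interzono \<Rightarrow> real ^ 'n" where
  "iz_upper D = (\<chi> j. min (zupper (fst D) $ j) (zupper (snd D) $ j))"

definition line :: "real \<Rightarrow> real \<Rightarrow> (real \<times> real) set" where
  "line k c = {(x, k * x + c) | x. True}"

definition bounding_lines ::
    "(real \<Rightarrow> real) \<Rightarrow> real \<Rightarrow> real \<Rightarrow> real \<Rightarrow> real \<Rightarrow> real \<Rightarrow> bool" where
  "bounding_lines f l u k c d \<longleftrightarrow> (\<forall>x\<in>{l..u}. k * x + d \<le> f x \<and> f x \<le> k * x + c)"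

definition tightest_bounding_lines ::
    "(real \<Rightarrow> real) \<Rightarrow> real \<Rightarrow> real \<Rightarrow> real \<Rightarrow> real \<Rightarrow> real \<Rightarrow> bool" where
  "tightest_bounding_lines f l u k c d \<longleftrightarrow>
     bounding_lines f l u k c d \<and>
     (\<forall>c' d'. bounding_lines f l u k c' d' \<longrightarrow>
        setdist (line k c) (line k d) \<le> setdist (line k c') (line k d'))"

definition vtanh :: "real ^ 'n::finite \<Rightarrow> real ^ 'n" where
  "vtanh x = (\<chi> j. tanh (x $ j))"

text \<open>When \<open>u $ j = l $ j\<close>, division by zero makes this slope \<open>0\<close>, which is the slope that the
  box-style transformer uses.\<close>

definition tanh_slope :: "real ^ 'n::finite \<Rightarrow> real ^ 'n \<Rightarrow> real ^ 'n" where
  "tanh_slope l u = (\<chi> j. (tanh (u $ j) - tanh (l $ j)) / (u $ j - l $ j))"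

text \<open>The generators appended to those of \<open>Z\<close> are indexed by the coordinates: the new index
  \<open>Inr j\<close> plays the role of \<open>N + j\<close>.\<close>

definition parallelogram_tanh ::
    "real ^ 'n::finite \<Rightarrow> real ^ 'n \<Rightarrow> real ^ 'n \<Rightarrow> real ^ 'n \<Rightarrow> ('i, 'n) zono \<Rightarrow> ('i + 'n, 'n) zono"
  where
  "parallelogram_tanh l u c d Z =
     \<lparr>idx = idx Z <+> UNIV,
      ctr = ctr Z * tanh_slope l u + (1 / 2) *\<^sub>R (c + d),
      gen = case_sum (\<lambda>i. gen Z i * tanh_slope l u) (\<lambda>j. ((c $ j - d $ j) / 2) *\<^sub>R axis j 1)\<rparr>"

definition box_tanh :: "real ^ 'n::finite \<Rightarrow> real ^ 'n \<Rightarrow> ('n, 'n) zono" where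
  "box_tanh l u =
     \<lparr>idx = UNIV,
      ctr = (1 / 2) *\<^sub>R (vtanh u + vtanh l),
      gen = (\<lambda>j. ((tanh (u $ j) - tanh (l $ j)) / 2) *\<^sub>R axis j 1)\<rparr>"

text \<open>Here \<open>c\<close> and \<open>d\<close> are the intercepts of the upper and lower bounding lines, to be constrained
  by \<open>tanh_intercepts\<close>. Both output zonotopes use the bounds of the whole InterZono, so a point of
  the main domain outside these bounds need not be mapped into the output by \<open>vtanh\<close>.\<close>

definition tanh_intercepts ::
    "('i, 's, 'n::finite) interzono \<Rightarrow> real ^ 'n \<Rightarrow> real ^ 'n \<Rightarrow> bool" where
  "tanh_intercepts D c d \<longleftrightarrow>
     (\<forall>j. tightest_bounding_lines tanh (iz_lower D $ j) (iz_upper D $ j)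
            (tanh_slope (iz_lower D) (iz_upper D) $ j) (c $ j) (d $ j))"

definition tanh_transformer ::
    "real ^ 'n::finite \<Rightarrow> real ^ 'n \<Rightarrow> ('i, 's, 'n) interzono \<Rightarrow> ('i + 'n, 'n, 'n) interzono" where
  "tanh_transformer c d D =
     (parallelogram_tanh (iz_lower D) (iz_upper D) c d (fst D), box_tanh (iz_lower D) (iz_upper D))"

end

theory Submission
  imports Defs
begin

text \<open>Everything reduces to one point \<open>x\<close> of the main domain lying within the
  bounds \<open>l\<close>, \<open>u\<close> of the InterZono. There, in each coordinate,
  \<open>tanh\<close> is trapped between the two bounding lines, and by monotonicity between its
  values at \<open>l\<close> and \<open>u\<close>. The first fact gives
  \<open>mem_parallelogram_tanh\<close>, the second \<open>mem_box_tanh\<close>; both express a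
  bounded deviation from a centre through fresh noise coefficients
  (\<open>symmetric_box_param\<close>). Points of \<open>iz_set D\<close> satisfy the bounds by the
  triangle inequality (\<open>zset_bounds\<close>). The lines control nothing outside the bounds, so
  the image of all of \<open>Zm\<close> is covered only under the stated inclusion. Tightness is
  that of an intersection.\<close>

lemma zset_bounds:
  fixes Z :: "('i, 'n::finite) zono"
  assumes "x \<in> zset Z"
  shows "zlower Z \<le> x" and "x \<le> zupper Z"
proof -
  obtain \<epsilon> where x: "x = ctr Z + (\<Sum>i\<in>idx Z. \<epsilon> i *\<^sub>R gen Z i)"
    and \<epsilon>: "\<And>i. i \<in> idx Z \<Longrightarrow> \<bar>\<epsilon> i\<bar> \<le> 1"
    using assms unfolding zset_def by (auto simp: abs_le_iff)
  have dev: "\<bar>x $ j - ctr Z $ j\<bar> \<le> (\<Sum>i\<in>idx Z. \<bar>gen Z i $ j\<bar>)" for j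
  proof -
    have "x $ j - ctr Z $ j = (\<Sum>i\<in>idx Z. \<epsilon> i * gen Z i $ j)"
      by (simp add: x)
    also have "\<bar>\<dots>\<bar> \<le> (\<Sum>i\<in>idx Z. \<bar>\<epsilon> i * gen Z i $ j\<bar>)"
      by (rule sum_abs)
    also have "\<dots> \<le> (\<Sum>i\<in>idx Z. \<bar>gen Z i $ j\<bar>)"
      using \<epsilon> by (intro sum_mono) (simp add: abs_mult mult_left_le_one_le)
    finally show ?thesis .
  qed
  show "zlower Z \<le> x" "x \<le> zupper Z"
    using dev by (auto simp: less_eq_vec_def zlower_def zupper_def abs_le_iff algebra_simps)
qed

lemma iz_set_subset_bounds: "iz_set D \<subseteq> {iz_lower D..iz_upper D}"
proof
  fix x
  assume "x \<in> iz_set D"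
  then have "x \<in> zset (fst D)" "x \<in> zset (snd D)"
    by (simp_all add: iz_set_def)
  note this[THEN zset_bounds(1)] this[THEN zset_bounds(2)]
  then show "x \<in> {iz_lower D..iz_upper D}"
    by (simp add: iz_lower_def iz_upper_def less_eq_vec_def)
qed

lemma sum_scaled_axis_nth:
  fixes r :: "'n::finite \<Rightarrow> real"
  shows "(\<Sum>i\<in>UNIV. r i *\<^sub>R axis i (1::real)) $ j = r j"
  by (simp add: axis_def if_distrib[of "(*) _"] cong: if_cong)

lemma symmetric_interval_param:
  fixes y m r :: real
  assumes "\<bar>y - m\<bar> \<le> r"
  obtains \<epsilon> where "\<epsilon> \<in> {-1..1}" "y = m + \<epsilon> * r"
proof
  \<comment> \<open>If \<open>r = 0\<close>, the quotient is 0 and the assumption forces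
    \<open>y = m\<close>.\<close>
  show "(y - m) / r \<in> {-1..1}"
    using assms by (cases "r = 0") (auto simp: abs_le_iff field_simps)
  show "y = m + (y - m) / r * r"
    using assms by (cases "r = 0") auto
qed

text \<open>An axis-parallel box is a zonotope: generators along distinct axes let each coordinate
  choose its noise coefficient independently.\<close>

lemma symmetric_box_param:
  fixes y m r :: "real ^ 'n::finite"
  assumes "\<And>j. \<bar>y $ j - m $ j\<bar> \<le> r $ j"
  obtains \<epsilon> where "\<And>j. \<epsilon> j \<in> {-1..1}"
    "y = m + (\<Sum>j\<in>UNIV. \<epsilon> j *\<^sub>R (r $ j *\<^sub>R axis j 1))"
proof -
  have "\<exists>e. e \<in> {-1..1} \<and> y $ j = m $ j + e * r $ j" for j
    using symmetric_interval_param[OF assms] by metis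
  then obtain \<epsilon> where \<epsilon>: "\<epsilon> j \<in> {-1..1}" "y $ j = m $ j + \<epsilon> j * r $ j" for j
    by metis
  have "y = m + (\<Sum>j\<in>UNIV. (\<epsilon> j * r $ j) *\<^sub>R axis j 1)"
    unfolding vec_eq_iff vector_add_component sum_scaled_axis_nth using \<epsilon>(2) by blast
  with \<epsilon>(1) show ?thesis
    by (intro that) simp_all
qed

lemma mem_box_tanh:
  assumes "\<And>j. tanh (l $ j) \<le> y $ j" and "\<And>j. y $ j \<le> tanh (u $ j)"
  shows "y \<in> zset (box_tanh l u)"
proof -
  \<comment> \<open>Lying in an interval means being within half its length of its midpoint.\<close>
  have "\<bar>y $ j - ((1 / 2) *\<^sub>R (vtanh u + vtanh l)) $ j\<bar>
      \<le> (\<chi> j. (tanh (u $ j) - tanh (l $ j)) / 2) $ j" for j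
    using assms[of j] by (simp add: vtanh_def abs_le_iff field_simps)
  from symmetric_box_param[OF this] show ?thesis
    unfolding zset_def box_tanh_def by auto
qed

text \<open>The noise coefficients of \<open>x\<close> are kept, so that the old generators
  reproduce the slope term exactly; the new ones only absorb the vertical offset of \<open>y\<close>
  from the line midway between the bounding lines.\<close>

lemma mem_parallelogram_tanh:
  fixes Z :: "('i, 'n::finite) zono"
  assumes "finite (idx Z)" and "x \<in> zset Z"
    and "\<And>j. tanh_slope l u $ j * x $ j + d $ j \<le> y $ j"
    and "\<And>j. y $ j \<le> tanh_slope l u $ j * x $ j + c $ j"
  shows "y \<in> zset (parallelogram_tanh l u c d Z)"
proof -
  let ?k = "tanh_slope l u"
  obtain \<epsilon> where x: "x = ctr Z + (\<Sum>i\<in>idx Z. \<epsilon> i *\<^sub>R gen Z i)"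
    and \<epsilon>: "\<forall>i\<in>idx Z. \<epsilon> i \<in> {-1..1}"
    using assms(2) unfolding zset_def by blast
  have "\<bar>y $ j - (x * ?k + (1 / 2) *\<^sub>R (c + d)) $ j\<bar> \<le> (\<chi> j. (c $ j - d $ j) / 2) $ j" for j
    using assms(3,4)[of j] by (simp add: abs_le_iff field_simps)
  then obtain \<delta> where \<delta>: "\<And>j. \<delta> j \<in> {-1..1}"
    and y: "y = x * ?k + (1 / 2) *\<^sub>R (c + d)
      + (\<Sum>j\<in>UNIV. \<delta> j *\<^sub>R ((\<chi> j. (c $ j - d $ j) / 2) $ j *\<^sub>R axis j 1))"
    using symmetric_box_param by blast
  \<comment> \<open>Componentwise scaling by the slopes is linear, hence the same
    \<open>\<epsilon>\<close> represents the scaled point.\<close>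
  have xk: "x * ?k = ctr Z * ?k + (\<Sum>i\<in>idx Z. \<epsilon> i *\<^sub>R (gen Z i * ?k))"
    by (simp add: x distrib_right sum_distrib_right)
  let ?P = "parallelogram_tanh l u c d Z"
  have "y = ctr ?P + (\<Sum>i\<in>idx ?P. case_sum \<epsilon> \<delta> i *\<^sub>R gen ?P i)"
    using assms(1) unfolding y xk by (simp add: parallelogram_tanh_def sum.Plus)
  moreover have "\<forall>i\<in>idx ?P. case_sum \<epsilon> \<delta> i \<in> {-1..1}"
    using \<epsilon> \<delta> by (auto simp: parallelogram_tanh_def)
  ultimately show ?thesis
    unfolding zset_def by blast
qed

lemma vtanh_mem_tanh_transformer:
  fixes D :: "('i, 's, 'n::finite) interzono"
  assumes "finite (idx (fst D))" and "tanh_intercepts D c d"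
    and "x \<in> zset (fst D)" and "x \<in> {iz_lower D..iz_upper D}"
  shows "vtanh x \<in> iz_set (tanh_transformer c d D)"
proof -
  have x: "x $ j \<in> {iz_lower D $ j..iz_upper D $ j}" for j
    using assms(4) by (simp add: less_eq_vec_def)
  with assms(2) have
    "tanh_slope (iz_lower D) (iz_upper D) $ j * x $ j + d $ j \<le> vtanh x $ j"
    "vtanh x $ j \<le> tanh_slope (iz_lower D) (iz_upper D) $ j * x $ j + c $ j" for j
    by (auto simp: tanh_intercepts_def tightest_bounding_lines_def bounding_lines_def vtanh_def)
  with assms(1,3)
  have "vtanh x \<in> zset (parallelogram_tanh (iz_lower D) (iz_upper D) c d (fst D))"
    by (rule mem_parallelogram_tanh)
  \<comment> \<open>Here only the monotonicity of \<open>tanh\<close> enters.\<close>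
  moreover have "vtanh x \<in> zset (box_tanh (iz_lower D) (iz_upper D))"
    using x by (intro mem_box_tanh) (simp_all add: vtanh_def)
  ultimately show ?thesis
    by (simp add: iz_set_def tanh_transformer_def)
qed

theorem theorem2:
  fixes Zm :: "('i, 'n::finite) zono" and Zs :: "('s, 'n) zono"
    and D :: "('i, 's, 'n) interzono" and D' :: "('i + 'n, 'n, 'n) interzono"
    and c d :: "real ^ 'n"
  assumes "finite (idx Zm)" and "finite (idx Zs)"
    and "D = (Zm, Zs)"
    and "tanh_intercepts D c d"
    and "D' = tanh_transformer c d D"
  shows "vtanh ` iz_set D \<subseteq> iz_set D' \<and>
    (zset Zm \<subseteq> {iz_lower D..iz_upper D} \<longrightarrow> vtanh ` zset Zm \<subseteq> iz_set D') \<and>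
    iz_set D' \<subseteq> zset (fst D') \<and>
    iz_set D' \<subseteq> zset (snd D')"
proof -
  \<comment> \<open>Serves both image inclusions: the bounds are automatic on
    \<open>iz_set D\<close> and assumed on \<open>zset Zm\<close>.\<close>
  have mem: "vtanh x \<in> iz_set D'" if "x \<in> zset Zm" "x \<in> {iz_lower D..iz_upper D}" for x
    using vtanh_mem_tanh_transformer[of D c d x] assms that by simp
  have "iz_set D \<subseteq> zset Zm"
    using assms(3) by (simp add: iz_set_def)
  then have "vtanh ` iz_set D \<subseteq> iz_set D'"
    using iz_set_subset_bounds mem by blast
  then show ?thesis
    using mem by (auto simp: iz_set_def)
qed

end
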